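(* Let $\mathcal B$ be a basis of $\mathbb X$ and assume that $\mathbf n$ has $l$-bounded quotient gaps. If $\mathcal B$ is $\Delta$-$\mathbf n$-symmetric for largest coefficients, then $\mathcal B$ is $\mathbf C$-symmetric for largest coefficients with $$\mathbf C\le\max\{1+2(n_1-1)\alpha_1\alpha_2,\ 1+2\Delta^2(1+l)\}.$$
   Context: $\mathbb X$ is a separable infinite-dimensional Banach space over $\mathbb F=\mathbb R$ or $\mathbb C$, with dual $\mathbb X^*$. A basis of $\mathbb X$ is a sequence $\mathcal B=(\mathbf e_i)_{i\in\mathbb N}\subset\mathbb X$ with closed linear span $\mathbb X$, having a (unique) sequence of biorthogonal functionals $(\mathbf e_i^* )_{i\in\mathbb N}\subset\mathbb X^*$ ($\mathbf e_k^*(\mathbf e_i)=\delta_{k,i}$), with $0<\inf_i\min\{\|\mathbf e_i\|,\|\mathbf e_i^*\|\}\le\sup_i\max\{\|\mathbf e_i\|,\|\mathbf e_i^*\|\}<\infty$. Put $\alpha_1=\sup_i\|\mathbf e_i\|$, $\alpha_2=\sup_i\|\mathbf e_i^*\|$, and $\operatorname{supp}(x)=\{i:\mathbf e_i^*(x)\ne0\}$. $\mathbf n=(n_k)_{k\in\mathbb N}$ is a strictly increasing sequence of positive integers, also regarded as a subset of $\mathbb N$ ($\mathbf n=\mathbb N$ is allowed). For an integer $l\ge2$, $\mathbf n$ has $l$-bounded quotient gaps if $n_{k+1}/n_k\le l$ for all $k$. For a finite $A\subset\mathbb N$, $\Psi_A$ is the set of families $\varepsilon=(\varepsilon_n)_{n\in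 A}\subset\mathbb F$ with $|\varepsilon_n|=1$, and $\mathbf 1_{\varepsilon A}=\sum_{n\in A}\varepsilon_n\mathbf e_n$. $\mathcal B$ is $\mathbf n$-symmetric for largest coefficients if there is $\mathbf C>0$ with $\|x+\mathbf 1_{\varepsilon A}\|\le\mathbf C\|x+\mathbf 1_{\varepsilon'B}\|$ for all $A,B\subset\mathbb N$ with $|A|\le|B|$, $A\cap B=\emptyset$, $|A|,|B|\in\mathbf n$, all $\varepsilon\in\Psi_A$, $\varepsilon'\in\Psi_B$, and all $x\in\mathbb X$ with $|\mathbf e_i^*(x)|\le1$ for all $i$ and $\operatorname{supp}(x)\cap(A\cup B)=\emptyset$. It is $\Delta$-$\mathbf n$-symmetric for largest coefficients if $\Delta$ is the smallest such constant. The prefix $\mathbf n$ is omitted when $\mathbf n=\mathbb N$. *)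

theory Defs
  imports "HOL-Analysis.Analysis"
begin

text \<open>
  The scalar field is a type of class \<open>real_normed_field\<close>. The norm of this class is
  multiplicative, so by the Gelfand--Mazur theorem such a field is isometrically isomorphic to
  the reals or to the complex numbers; \<open>'f = real\<close> and \<open>'f = complex\<close> are the two cases.
  As the type class \<open>banach\<close> only provides real scalar multiplication, the
  multiplication by scalars of type \<open>'f\<close> is the parameter \<open>scl\<close>, which extends the real one.
\<close>

locale separable_banach_space = vector_space scl
  for scl :: "'f::real_normed_field \<Rightarrow> 'a::banach \<Rightarrow> 'a" +
  assumes norm_scale: "norm (scl c x) = norm c * norm x"
    and scale_of_real: "scl (of_real r) x = r *\<^sub>R x"
    and separable: "separable_space (euclidean :: 'a topology)"
    and infinite_dimensional: "\<not> (\<exists>S. finite S \<and> local.span S = UNIV)"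

definition dual_functional ::
  "('f::real_normed_field \<Rightarrow> 'a::banach \<Rightarrow> 'a) \<Rightarrow> ('a \<Rightarrow> 'f) \<Rightarrow> bool"
  where "dual_functional scl f \<longleftrightarrow> bounded_linear f \<and> (\<forall>c x. f (scl c x) = c * f x)"

text \<open>
  Basis vectors are indexed by \<open>nat\<close>, starting at \<open>0\<close>. The biorthogonal functionals \<open>e'\<close> are a
  parameter; they are determined by \<open>e\<close> (lemma \<open>biorthogonal_unique\<close> below).
  The norm of the dual space is \<open>onorm\<close>. The norms being nonnegative, the infimum below is over a
  set bounded from below, and \<open>bdd_above\<close> expresses that the supremum is finite.
\<close>

locale basis = separable_banach_space scl
  for scl :: "'f::real_normed_field \<Rightarrow> 'a::banach \<Rightarrow> 'a"
    and e :: "nat \<Rightarrow> 'a" and e' :: "nat \<Rightarrow> 'a \<Rightarrow> 'f" +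
  assumes closed_span: "closure (local.span (range e)) = UNIV"
    and dual: "dual_functional scl (e' k)"
    and biorthogonal: "e' k (e i) = (if k = i then 1 else 0)"
    and seminormalized_below: "0 < (INF i. min (norm (e i)) (onorm (e' i)))"
    and seminormalized_above: "bdd_above (range (\<lambda>i. max (norm (e i)) (onorm (e' i))))"

lemma biorthogonal_unique:
  assumes e': "basis scl e e'" and e'': "basis scl e e''"
  shows "e' = e''"
proof (intro ext)
  interpret A: basis scl e e' by fact
  interpret B: basis scl e e'' by fact
  fix k x
  have blA: "bounded_linear (e' k)" and blB: "bounded_linear (e'' k)"
    using A.dual B.dual by (auto simp: dual_functional_def)
  define Z where "Z = {y. e' k y = e'' k y}"
  have "closed Z"
    unfolding Z_def
    by (intro closed_Collect_eq linear_continuous_on blA blB)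
  moreover have "A.span (range e) \<subseteq> Z"
  proof (rule A.span_minimal)
    show "range e \<subseteq> Z"
      by (auto simp: Z_def A.biorthogonal B.biorthogonal)
    show "A.subspace Z"
      using A.dual[of k] B.dual[of k]
      by (auto simp: A.subspace_def Z_def dual_functional_def
          linear_simps(1)[OF blA] linear_simps(1)[OF blB]
          linear_simps(3)[OF blA] linear_simps(3)[OF blB])
  qed
  ultimately have "closure (A.span (range e)) \<subseteq> Z"
    by (rule closure_minimal[rotated])
  then show "e' k x = e'' k x"
    by (auto simp: A.closed_span Z_def)
qed

definition alpha1 :: "(nat \<Rightarrow> 'a::banach) \<Rightarrow> real"
  where "alpha1 e = (SUP i. norm (e i))"

definition alpha2 :: "(nat \<Rightarrow> 'a::banach \<Rightarrow> 'f::real_normed_field) \<Rightarrow> real"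
  where "alpha2 e' = (SUP i. onorm (e' i))"

definition supp :: "(nat \<Rightarrow> 'a \<Rightarrow> 'f::zero) \<Rightarrow> 'a \<Rightarrow> nat set"
  where "supp e' x = {i. e' i x \<noteq> 0}"

text \<open>Families indexed by \<open>A\<close> are total functions whose values outside \<open>A\<close> are irrelevant.\<close>

definition Psi :: "nat set \<Rightarrow> (nat \<Rightarrow> 'f::real_normed_field) set"
  where "Psi A = {\<epsilon>. \<forall>n\<in>A. norm (\<epsilon> n) = 1}"

definition indic ::
  "('f \<Rightarrow> 'a::banach \<Rightarrow> 'a) \<Rightarrow> (nat \<Rightarrow> 'a) \<Rightarrow> (nat \<Rightarrow> 'f) \<Rightarrow> nat set \<Rightarrow> 'a"
  where "indic scl e \<epsilon> A = (\<Sum>n\<in>A. scl (\<epsilon> n) (e n))"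

text \<open>
  A strictly increasing sequence of positive integers \<open>n\<^sub>1 < n\<^sub>2 < \<dots>\<close> is a function
  \<open>n :: nat \<Rightarrow> nat\<close> with \<open>n k\<close> standing for \<open>n\<^sub>k\<^sub>+\<^sub>1\<close>; as a subset of the positive integers it
  is \<open>range n\<close>. In particular the sequence of all positive integers is \<open>Suc\<close>.
\<close>

definition positive_increasing :: "(nat \<Rightarrow> nat) \<Rightarrow> bool"
  where "positive_increasing n \<longleftrightarrow> strict_mono n \<and> (\<forall>k. 0 < n k)"

definition bounded_quotient_gaps :: "nat \<Rightarrow> (nat \<Rightarrow> nat) \<Rightarrow> bool"
  where "bounded_quotient_gaps l n \<longleftrightarrow> (\<forall>k. real (n (Suc k)) / real (n k) \<le> real l)"

definition symmetric_const ::
  "('f::real_normed_field \<Rightarrow> 'a::banach \<Rightarrow> 'a) \<Rightarrow> (nat \<Rightarrow> 'a) \<Rightarrow> (nat \<Rightarrow> 'a \<Rightarrow> 'f)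
     \<Rightarrow> (nat \<Rightarrow> nat) \<Rightarrow> real \<Rightarrow> bool"
  where "symmetric_const scl e e' n C \<longleftrightarrow>
    C > 0 \<and>
    (\<forall>A B \<epsilon> \<epsilon>' x.
       finite A \<and> finite B \<and> card A \<le> card B \<and> A \<inter> B = {} \<and>
       card A \<in> range n \<and> card B \<in> range n \<and>
       \<epsilon> \<in> Psi A \<and> \<epsilon>' \<in> Psi B \<and>
       (\<forall>i. norm (e' i x) \<le> 1) \<and> supp e' x \<inter> (A \<union> B) = {} \<longrightarrow>
       norm (x + indic scl e \<epsilon> A) \<le> C * norm (x + indic scl e \<epsilon>' B))"

text \<open>The basis is \<open>\<Delta>\<close>-\<open>n\<close>-symmetric for largest coefficients: \<open>\<Delta>\<close> is the smallest constant.\<close>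

definition n_symmetric_largest ::
  "('f::real_normed_field \<Rightarrow> 'a::banach \<Rightarrow> 'a) \<Rightarrow> (nat \<Rightarrow> 'a) \<Rightarrow> (nat \<Rightarrow> 'a \<Rightarrow> 'f)
     \<Rightarrow> (nat \<Rightarrow> nat) \<Rightarrow> real \<Rightarrow> bool"
  where "n_symmetric_largest scl e e' n \<Delta> \<longleftrightarrow>
    symmetric_const scl e e' n \<Delta> \<and> (\<forall>C. symmetric_const scl e e' n C \<longrightarrow> \<Delta> \<le> C)"

definition symmetric_largest ::
  "('f::real_normed_field \<Rightarrow> 'a::banach \<Rightarrow> 'a) \<Rightarrow> (nat \<Rightarrow> 'a) \<Rightarrow> (nat \<Rightarrow> 'a \<Rightarrow> 'f)
     \<Rightarrow> real \<Rightarrow> bool"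
  where "symmetric_largest scl e e' C \<longleftrightarrow> n_symmetric_largest scl e e' Suc C"

end

theory Submission
  imports Defs
begin

text \<open>
  Let \<open>1\<^sub>A\<close> and \<open>1\<^sub>B\<close> be the two signed indicators and \<open>t = \<parallel>x + 1\<^sub>B\<parallel>\<close>. As
  \<open>\<parallel>x + 1\<^sub>A\<parallel> \<le> t + \<parallel>1\<^sub>A\<parallel> + \<parallel>1\<^sub>B\<parallel>\<close>, the task is to bound the two indicators alone by multiples
  of \<open>t\<close>.

  If \<open>B\<close> has fewer than \<open>n\<^sub>1\<close> elements, then each indicator has norm at most \<open>(n\<^sub>1 - 1) \<alpha>\<^sub>1\<close>, and
  any one coordinate in \<open>B\<close> shows \<open>1 \<le> \<alpha>\<^sub>2 t\<close>.

  Otherwise let \<open>m\<close> be the largest member of the sequence with \<open>m \<le> |B|\<close>; the gap condition gives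
  \<open>|A| \<le> |B| \<le> l m\<close>, so each of \<open>A\<close> and \<open>B\<close> splits into \<open>l\<close> pieces with at most \<open>m\<close> elements. The
  vector \<open>x\<close> may have full support, but its coordinates tend to \<open>0\<close>, so after an arbitrarily small
  perturbation there is a set \<open>D\<close> of \<open>m\<close> fresh indices on which it vanishes. Half the difference of
  two vectors obtained from each other by flipping the signs on \<open>P\<close> is the indicator of \<open>P\<close>, so
  symmetry applied to both of them bounds the indicator of \<open>P\<close> (lemma \<open>norm_indic_le\<close>). Pieces
  of \<open>A\<close>, completed to \<open>m\<close> elements by indices from \<open>D\<close>, are thus compared with \<open>m\<close> elements of
  \<open>B\<close>, the remainder of \<open>B\<close> being absorbed into \<open>x\<close>; this costs \<open>\<Delta>\<close> per piece. Pieces of \<open>B\<close> cannot be compared with \<open>B\<close> directly,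
  because symmetry needs disjoint sets; they are compared with \<open>D\<close>, and \<open>D\<close> with \<open>B\<close>, at cost \<open>\<Delta>\<^sup>2\<close>
  per piece. As \<open>\<Delta> \<ge> 1\<close>, the total is at most \<open>(1 + 2 l \<Delta>\<^sup>2) t\<close>.
\<close>

section \<open>Coordinates and signed indicators\<close>

context basis
begin

lemma dual_bounded_linear: "bounded_linear (e' k)"
  using dual by (auto simp: dual_functional_def)

lemma dual_scale: "e' k (scl c x) = c * e' k x"
  using dual by (auto simp: dual_functional_def)

lemmas dual_simps = linear_simps[OF dual_bounded_linear] dual_scale

lemma norm_e_le: "norm (e i) \<le> alpha1 e"
proof -
  have "bdd_above (range (\<lambda>i. norm (e i)))"
    using seminormalized_above unfolding bdd_above_def by fastforce
  then show ?thesis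
    unfolding alpha1_def by (rule cSUP_upper[OF UNIV_I])
qed

lemma alpha1_nonneg: "0 \<le> alpha1 e"
  using norm_e_le[of 0] norm_ge_zero order_trans by blast

lemma onorm_dual_le: "onorm (e' i) \<le> alpha2 e'"
proof -
  have "bdd_above (range (\<lambda>i. onorm (e' i)))"
    using seminormalized_above unfolding bdd_above_def by fastforce
  then show ?thesis
    unfolding alpha2_def by (rule cSUP_upper[OF UNIV_I])
qed

lemma alpha2_nonneg: "0 \<le> alpha2 e'"
  using onorm_dual_le[of 0] onorm_pos_le[OF dual_bounded_linear] order_trans by blast

lemma norm_dual_le: "norm (e' i x) \<le> alpha2 e' * norm x"
proof -
  have "norm (e' i x) \<le> onorm (e' i) * norm x"
    by (rule onorm[OF dual_bounded_linear])
  also have "\<dots> \<le> alpha2 e' * norm x"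
    by (intro mult_right_mono onorm_dual_le) auto
  finally show ?thesis .
qed

lemma dual_indic:
  assumes "finite A"
  shows "e' i (indic scl e \<epsilon> A) = (if i \<in> A then \<epsilon> i else 0)"
proof -
  have "e' i (indic scl e \<epsilon> A) = (\<Sum>k\<in>A. \<epsilon> k * (if i = k then 1 else 0))"
    unfolding indic_def linear_sum[OF bounded_linear.linear[OF dual_bounded_linear]]
    by (simp add: dual_scale biorthogonal)
  also have "\<dots> = (\<Sum>k\<in>A. if i = k then \<epsilon> k else 0)"
    by (rule sum.cong) auto
  finally show ?thesis
    using assms by simp
qed

lemma norm_indic_le_card:
  assumes "\<And>i. i \<in> A \<Longrightarrow> norm (\<epsilon> i) \<le> c"
  shows "norm (indic scl e \<epsilon> A) \<le> real (card A) * (c * alpha1 e)"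
proof -
  have "norm (\<epsilon> i) * norm (e i) \<le> c * alpha1 e" if "i \<in> A" for i
    using assms[OF that] norm_e_le[of i]
    by (intro mult_mono) (auto intro: order_trans[OF norm_ge_zero])
  then show ?thesis
    unfolding indic_def by (intro sum_norm_bound) (simp add: norm_scale)
qed

lemma indic_Un:
  assumes "finite A" "finite B" "A \<inter> B = {}"
  shows "indic scl e \<epsilon> (A \<union> B) = indic scl e \<epsilon> A + indic scl e \<epsilon> B"
  unfolding indic_def using assms by (rule sum.union_disjoint)

lemma indic_cong: "(\<And>i. i \<in> A \<Longrightarrow> \<epsilon> i = \<eta> i) \<Longrightarrow> indic scl e \<epsilon> A = indic scl e \<eta> A"
  unfolding indic_def by (rule sum.cong) auto

lemma indic_uminus: "indic scl e (\<lambda>i. - \<epsilon> i) A = - indic scl e \<epsilon> A"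
  unfolding indic_def by (simp add: sum_negf)

lemma finite_supp_span:
  assumes "u \<in> span (range e)"
  shows "finite (supp e' u)"
  using assms
proof (induction rule: span_induct_alt)
  case base
  then show ?case by (simp add: supp_def dual_simps)
next
  case (step c b v)
  then obtain j where j: "b = e j" by auto
  have "supp e' (scl c b + v) \<subseteq> insert j (supp e' v)"
    by (auto simp: supp_def dual_simps j biorthogonal)
  then show ?case
    using step finite_subset by blast
qed

text \<open>
  Coordinates tend to \<open>0\<close>: the coordinates of \<open>x\<close> are uniformly close to those of an element of the
  dense span, which has only finitely many.
\<close>

lemma finite_large_coordinates:
  assumes "\<delta> > 0"
  shows "finite {i. norm (e' i x) \<ge> \<delta>}"
proof -
  define r where "r = \<delta> / (alpha2 e' + 1)"
  have "r > 0"
    using assms alpha2_nonneg by (simp add: r_def add_nonneg_pos)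
  moreover have "x \<in> closure (span (range e))"
    by (simp add: closed_span)
  ultimately obtain u where u: "u \<in> span (range e)" "dist u x < r"
    by (meson closure_approachable)
  have "norm (e' i x) < \<delta>" if "i \<notin> supp e' u" for i
  proof -
    have "e' i x = - e' i (u - x)"
      using that by (simp add: supp_def dual_simps)
    then have "norm (e' i x) \<le> alpha2 e' * norm (u - x)"
      using norm_dual_le[of i "u - x"] by simp
    also have "\<dots> \<le> alpha2 e' * r"
      using u alpha2_nonneg by (intro mult_left_mono) (auto simp: dist_norm)
    also have "\<dots> < (alpha2 e' + 1) * r"
      using \<open>r > 0\<close> by (simp add: algebra_simps)
    also have "\<dots> = \<delta>"
      using alpha2_nonneg by (simp add: r_def add_nonneg_eq_0_iff)
    finally show ?thesis .
  qed
  then have "{i. norm (e' i x) \<ge> \<delta>} \<subseteq> supp e' u"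
    by (auto simp: not_less[symmetric])
  then show ?thesis
    using finite_supp_span[OF u(1)] finite_subset by blast
qed

text \<open>
  This perturbation supplies fresh indices even if \<open>x\<close> has full support: the coordinates of \<open>x\<close> on
  a set \<open>D\<close> where they are tiny are replaced by \<open>0\<close>.
\<close>

lemma perturb_off_fresh_set:
  assumes "finite F" "\<eta> > 0"
  obtains D y where "finite D" "card D = m" "D \<inter> F = {}" "norm (y - x) \<le> \<eta>"
    "\<And>i. e' i y = (if i \<in> D then 0 else e' i x)"
proof -
  define \<delta> where "\<delta> = \<eta> / (real m * alpha1 e + 1)"
  have pos: "real m * alpha1 e + 1 > 0"
    using alpha1_nonneg by (simp add: add_nonneg_pos)
  then have "\<delta> > 0"
    using assms by (simp add: \<delta>_def)
  then have "finite (F \<union> {i. norm (e' i x) \<ge> \<delta>})"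
    using assms finite_large_coordinates by blast
  then have "infinite (- (F \<union> {i. norm (e' i x) \<ge> \<delta>}))"
    unfolding Compl_eq_Diff_UNIV by (intro Diff_infinite_finite infinite_UNIV_nat)
  then obtain D where D: "finite D" "card D = m" "D \<subseteq> - (F \<union> {i. norm (e' i x) \<ge> \<delta>})"
    by (metis infinite_arbitrarily_large)
  define y where "y = x - indic scl e (\<lambda>i. e' i x) D"
  have "norm (y - x) = norm (indic scl e (\<lambda>i. e' i x) D)"
    by (simp add: y_def)
  also have "\<dots> \<le> real m * (\<delta> * alpha1 e)"
    using D by (intro norm_indic_le_card[where c = \<delta>, of D, unfolded D(2)]) force
  also have "\<dots> \<le> \<delta> * (real m * alpha1 e + 1)"
    using \<open>\<delta> > 0\<close> by (simp add: algebra_simps)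
  also have "\<dots> = \<eta>"
    using pos by (simp add: \<delta>_def)
  finally have "norm (y - x) \<le> \<eta>" .
  moreover have "e' i y = (if i \<in> D then 0 else e' i x)" for i
    using D(1) by (simp add: y_def dual_simps dual_indic)
  ultimately show ?thesis
    using D that by blast
qed

section \<open>Consequences of symmetry\<close>

lemma symmetric_constD:
  assumes "symmetric_const scl e e' n C" "finite A" "finite B" "card A \<le> card B" "A \<inter> B = {}"
    "card A \<in> range n" "card B \<in> range n" "\<epsilon> \<in> Psi A" "\<epsilon>' \<in> Psi B"
    "\<And>i. norm (e' i x) \<le> 1" "supp e' x \<inter> (A \<union> B) = {}"
  shows "norm (x + indic scl e \<epsilon> A) \<le> C * norm (x + indic scl e \<epsilon>' B)"
  using assms unfolding symmetric_const_def by blast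

text \<open>Exchanging two sets of equal size shows \<open>a \<le> C b \<le> C\<^sup>2 a\<close> with \<open>a > 0\<close>.\<close>

lemma symmetric_const_ge_1:
  assumes C: "symmetric_const scl e e' n C" and n: "positive_increasing n"
  shows "1 \<le> C"
proof -
  define m where "m = n 0"
  have m: "m > 0" "m \<in> range n"
    using n by (auto simp: positive_increasing_def m_def)
  define A where "A = {..<m}"
  define B where "B = {m..<2 * m}"
  define a where "a = norm (indic scl e (\<lambda>_. 1) A)"
  define b where "b = norm (indic scl e (\<lambda>_. 1) B)"
  have AB: "finite A" "finite B" "card A = m" "card B = m" "A \<inter> B = {}" "B \<inter> A = {}"
    by (auto simp: A_def B_def)
  have z: "norm (e' i 0) \<le> 1" "supp e' 0 = {}" for i
    by (auto simp: dual_simps supp_def)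
  have P: "(\<lambda>_. 1) \<in> (Psi S :: (nat \<Rightarrow> 'f) set)" for S
    by (simp add: Psi_def)
  have ab: "a \<le> C * b"
    using symmetric_constD[OF C AB(1,2) _ AB(5) _ _ P P z(1)] m AB z(2) by (simp add: a_def b_def)
  have ba: "b \<le> C * a"
    using symmetric_constD[OF C AB(2,1) _ AB(6) _ _ P P z(1)] m AB z(2) by (simp add: a_def b_def)
  have "C > 0"
    using C by (simp add: symmetric_const_def)
  then have "a \<le> C * (C * a)"
    using ab ba by (meson mult_left_mono order_trans less_imp_le)
  moreover have "a > 0"
  proof -
    have "e' 0 (indic scl e (\<lambda>_. 1) A) \<noteq> 0"
      using m by (simp add: dual_indic AB A_def)
    then show ?thesis
      by (auto simp: a_def dual_simps)
  qed
  ultimately have "1 \<le> C * C"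
    by (simp flip: mult.assoc)
  then show ?thesis
    using \<open>C > 0\<close> by (smt (verit) mult_less_cancel_left2)
qed

text \<open>
  The infimum of the admissible constants is positive, being at least \<open>1\<close>, and is itself admissible,
  because each defining inequality is closed in the constant.
\<close>

lemma smallest_symmetric_const:
  assumes M: "symmetric_const scl e e' n M" and n: "positive_increasing n"
  shows "\<exists>C. n_symmetric_largest scl e e' n C \<and> C \<le> M"
proof -
  define S where "S = {C. symmetric_const scl e e' n C}"
  have MS: "M \<in> S"
    using M by (simp add: S_def)
  have ge1: "1 \<le> C" if "C \<in> S" for C
    using that symmetric_const_ge_1[OF _ n] by (simp add: S_def)
  then have bdd: "bdd_below S"
    by (rule bdd_belowI)
  have "1 \<le> Inf S"
    using MS ge1 by (intro cInf_greatest) auto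
  moreover have "norm u \<le> Inf S * norm v"
    if uv: "\<And>C. C \<in> S \<Longrightarrow> norm u \<le> C * norm v" for u v :: 'a
  proof (cases "v = 0")
    case True
    then show ?thesis
      using uv[OF MS] by simp
  next
    case False
    then have "norm u / norm v \<le> Inf S"
      using MS uv by (intro cInf_greatest) (auto simp: divide_le_eq)
    then show ?thesis
      using False by (simp add: divide_le_eq)
  qed
  ultimately have "symmetric_const scl e e' n (Inf S)"
    unfolding symmetric_const_def[of _ _ _ _ "Inf S"]
    using symmetric_constD[of n] by (simp add: S_def)
  then show ?thesis
    using MS bdd by (auto simp: n_symmetric_largest_def S_def intro: cInf_lower)
qed

text \<open>
  Symmetry applies to \<open>R\<close> with the signs \<open>\<epsilon>\<close> on \<open>P\<close> and also with the signs \<open>- \<epsilon>\<close> on \<open>P\<close>; the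
  difference of the two resulting vectors is twice the indicator of \<open>P\<close>. The superset \<open>R\<close> is there
  because \<open>P\<close> itself need not have an admissible size.
\<close>

lemma norm_indic_le:
  assumes C: "symmetric_const scl e e' n C"
    and R: "finite R" "P \<subseteq> R" "card R = card Q" and Q: "finite Q" "card Q \<in> range n"
    and disj: "R \<inter> Q = {}" "supp e' z \<inter> (R \<union> Q) = {}" and z: "\<And>i. norm (e' i z) \<le> 1"
    and \<epsilon>: "\<epsilon> \<in> Psi P" and \<eta>: "\<eta> \<in> Psi Q"
  shows "norm (indic scl e \<epsilon> P) \<le> C * norm (z + indic scl e \<eta> Q)"
proof -
  define t where "t = C * norm (z + indic scl e \<eta> Q)"
  define w where "w = z + indic scl e (\<lambda>_. 1) (R - P)"
  have bound: "norm (w + indic scl e \<zeta> P) \<le> t" if \<zeta>: "\<zeta> \<in> Psi P" for \<zeta>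
  proof -
    define \<theta> where "\<theta> = (\<lambda>i. if i \<in> P then \<zeta> i else 1)"
    have "\<theta> \<in> Psi R"
      using \<zeta> by (auto simp: Psi_def \<theta>_def)
    then have "norm (z + indic scl e \<theta> R) \<le> t"
      unfolding t_def using R Q by (intro symmetric_constD[OF C] disj z \<eta>) auto
    moreover have "indic scl e \<theta> (P \<union> (R - P)) = indic scl e \<theta> P + indic scl e \<theta> (R - P)"
      using R finite_subset by (intro indic_Un) auto
    moreover have "indic scl e \<theta> P = indic scl e \<zeta> P"
      by (rule indic_cong) (simp add: \<theta>_def)
    moreover have "indic scl e \<theta> (R - P) = indic scl e (\<lambda>_. 1) (R - P)"
      by (rule indic_cong) (simp add: \<theta>_def)
    moreover have "P \<union> (R - P) = R"
      using R by blast
    ultimately show ?thesis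
      by (simp add: w_def algebra_simps)
  qed
  have "(\<lambda>i. - \<epsilon> i) \<in> Psi P"
    using \<epsilon> by (simp add: Psi_def)
  from bound[OF this] have "norm (w - indic scl e \<epsilon> P) \<le> t"
    by (simp add: indic_uminus)
  then have "norm ((w + indic scl e \<epsilon> P) - (w - indic scl e \<epsilon> P)) \<le> t + t"
    using bound[OF \<epsilon>] norm_triangle_le_diff[of "w + indic scl e \<epsilon> P"] by (meson add_mono)
  also have "(w + indic scl e \<epsilon> P) - (w - indic scl e \<epsilon> P) = 2 *\<^sub>R indic scl e \<epsilon> P"
    by (simp add: scaleR_2)
  finally show ?thesis
    by (simp add: t_def)
qed

lemma norm_indic_le_pieces:
  assumes "finite S" "card S \<le> l * m"
    and "\<And>P. P \<subseteq> S \<Longrightarrow> card P \<le> m \<Longrightarrow> norm (indic scl e \<epsilon> P) \<le> K"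
  shows "norm (indic scl e \<epsilon> S) \<le> real l * K"
  using assms
proof (induction l arbitrary: S)
  case 0
  then show ?case by (simp add: indic_def)
next
  case (Suc l)
  obtain P where P: "P \<subseteq> S" "card P = min m (card S)"
    using obtain_subset_with_card_n[of "min m (card S)" S] by auto
  have fin: "finite P" "finite (S - P)"
    using P Suc.prems(1) finite_subset by auto
  have "card (S - P) = card S - card P"
    using P fin by (simp add: card_Diff_subset)
  then have "card (S - P) \<le> l * m"
    using P Suc.prems(2) by auto
  then have "norm (indic scl e \<epsilon> (S - P)) \<le> real l * K"
    using Suc.prems(3) fin by (intro Suc.IH) auto
  moreover have "norm (indic scl e \<epsilon> P) \<le> K"
    using P by (intro Suc.prems(3)) auto
  moreover have "indic scl e \<epsilon> S = indic scl e \<epsilon> P + indic scl e \<epsilon> (S - P)"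
    using indic_Un[of P "S - P" \<epsilon>] fin P by (simp add: Un_absorb1)
  ultimately show ?case
    by (simp add: distrib_right norm_triangle_le)
qed

section \<open>The two ranges of sizes\<close>

lemma small_sets_estimate:
  assumes "finite B" "card A \<le> card B" "B \<noteq> {}" "card B < N"
    and \<epsilon>: "\<epsilon> \<in> Psi A" and \<eta>: "\<eta> \<in> Psi B" and "supp e' x \<inter> B = {}"
  shows "norm (x + indic scl e \<epsilon> A)
    \<le> (1 + 2 * (real N - 1) * alpha1 e * alpha2 e') * norm (x + indic scl e \<eta> B)"
proof -
  define t where "t = norm (x + indic scl e \<eta> B)"
  obtain i where i: "i \<in> B"
    using assms by auto
  have "e' i (x + indic scl e \<eta> B) = \<eta> i"
    using assms i by (auto simp: dual_simps dual_indic supp_def)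
  then have t: "1 \<le> alpha2 e' * t"
    using norm_dual_le[of i "x + indic scl e \<eta> B"] \<eta> i by (simp add: t_def Psi_def)
  have ind: "norm (indic scl e \<zeta> S) \<le> (real N - 1) * alpha1 e * (alpha2 e' * t)"
    if "\<zeta> \<in> Psi S" "card S \<le> card B" for \<zeta> S
  proof -
    have "norm (indic scl e \<zeta> S) \<le> real (card S) * (1 * alpha1 e)"
      using that by (intro norm_indic_le_card) (auto simp: Psi_def)
    also have "\<dots> \<le> (real N - 1) * alpha1 e"
      using that assms alpha1_nonneg by (auto intro!: mult_right_mono)
    also have "\<dots> \<le> (real N - 1) * alpha1 e * (alpha2 e' * t)"
      using mult_left_mono[OF t, of "(real N - 1) * alpha1 e"] assms alpha1_nonneg by simp
    finally show ?thesis .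
  qed
  have "x + indic scl e \<epsilon> A = (x + indic scl e \<eta> B) + (indic scl e \<epsilon> A - indic scl e \<eta> B)"
    by simp
  then have "norm (x + indic scl e \<epsilon> A)
    \<le> t + (norm (indic scl e \<epsilon> A) + norm (indic scl e \<eta> B))"
    unfolding t_def by (metis norm_triangle_mono norm_triangle_ineq4 order_refl)
  also have "\<dots> \<le> t + ((real N - 1) * alpha1 e * (alpha2 e' * t)
      + (real N - 1) * alpha1 e * (alpha2 e' * t))"
    using ind[OF \<epsilon>] ind[OF \<eta>] assms by (intro add_mono) auto
  finally show ?thesis
    by (simp add: t_def algebra_simps)
qed

text \<open>
  The set \<open>D\<close> serves twice: it pads pieces of \<open>A\<close> to the admissible size \<open>m\<close>, and it mediates
  between a piece of \<open>B\<close> and \<open>B\<close> itself.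
\<close>

lemma large_sets_estimate_fresh:
  assumes C: "symmetric_const scl e e' n C" "1 \<le> C" and m: "m \<in> range n"
    and fin: "finite A" "finite B" "finite D" and card: "card D = m" "m \<le> card B"
      "card A \<le> l * m" "card B \<le> l * m"
    and disj: "A \<inter> B = {}" "D \<inter> (A \<union> B) = {}" "supp e' y \<inter> (A \<union> B \<union> D) = {}"
    and \<epsilon>: "\<epsilon> \<in> Psi A" and \<eta>: "\<eta> \<in> Psi B" and y: "\<And>i. norm (e' i y) \<le> 1"
  shows "norm (y + indic scl e \<epsilon> A) \<le> (1 + 2 * real l * C\<^sup>2) * norm (y + indic scl e \<eta> B)"
proof -
  define t where "t = norm (y + indic scl e \<eta> B)"
  have t: "t \<ge> 0"
    by (simp add: t_def)
  obtain Q where Q: "Q \<subseteq> B" "card Q = m" "finite Q"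
    using obtain_subset_with_card_n[OF card(2)] by auto
  \<comment> \<open>The part of \<open>B\<close> beyond \<open>m\<close> elements joins the vector; its coordinates have modulus \<open>1\<close>.\<close>
  define z where "z = y + indic scl e \<eta> (B - Q)"
  have zQ: "z + indic scl e \<eta> Q = y + indic scl e \<eta> B"
    using indic_Un[of Q "B - Q" \<eta>] fin Q by (simp add: z_def Un_absorb2 ac_simps)
  have dz: "e' i z = (if i \<in> B - Q then \<eta> i else e' i y)" for i
    using disj(3) fin by (auto simp: z_def dual_simps dual_indic supp_def)
  have z1: "norm (e' i z) \<le> 1" for i
    using \<eta> y by (auto simp: dz Psi_def)
  have suppz: "supp e' z \<inter> (A \<union> D \<union> Q) = {}"
    using disj Q by (auto simp: supp_def dz)
  have \<eta>Q: "\<eta> \<in> Psi Q"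
    using \<eta> Q by (auto simp: Psi_def)
  have pieceA: "norm (indic scl e \<epsilon> P) \<le> C * t" if P: "P \<subseteq> A" "card P \<le> m" for P
  proof -
    have finP: "finite P"
      using P fin finite_subset by blast
    obtain E where E: "E \<subseteq> D" "card E = m - card P" "finite E"
      using obtain_subset_with_card_n[of "m - card P" D] card by auto
    have "card (P \<union> E) = card P + card E"
      using P E disj finP by (intro card_Un_disjoint) auto
    then have "card (P \<union> E) = card Q"
      using P E Q by simp
    then have "norm (indic scl e \<epsilon> P) \<le> C * norm (z + indic scl e \<eta> Q)"
      using P E Q finP m disj suppz z1 \<eta>Q \<epsilon>
      by (intro norm_indic_le[OF C(1), of "P \<union> E"]) (auto simp: Psi_def)
    then show ?thesis
      by (simp add: zQ t_def)
  qed
  have "norm (indic scl e (\<lambda>_. 1) D) \<le> C * norm (z + indic scl e \<eta> Q)"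
    using fin Q m disj suppz z1 \<eta>Q card
    by (intro norm_indic_le[OF C(1), of D]) (auto simp: Psi_def)
  then have D: "norm (indic scl e (\<lambda>_. 1) D) \<le> C * t"
    by (simp add: zQ t_def)
  have pieceB: "norm (indic scl e \<eta> P) \<le> C\<^sup>2 * t" if P: "P \<subseteq> B" "card P \<le> m" for P
  proof -
    obtain R where R: "P \<subseteq> R" "R \<subseteq> B" "card R = m"
      using exists_subset_between[of P m B] P card fin by blast
    have "norm (indic scl e \<eta> P) \<le> C * norm (0 + indic scl e (\<lambda>_. 1) D)"
      using R P m disj fin card \<eta> finite_subset[OF R(2)]
      by (intro norm_indic_le[OF C(1), of R]) (auto simp: Psi_def supp_def dual_simps)
    also have "\<dots> \<le> C * (C * t)"
      using D C by (intro mult_left_mono) auto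
    finally show ?thesis
      by (simp add: power2_eq_square)
  qed
  have A: "norm (indic scl e \<epsilon> A) \<le> real l * (C * t)"
    by (rule norm_indic_le_pieces[OF fin(1) card(3) pieceA])
  have B: "norm (indic scl e \<eta> B) \<le> real l * (C\<^sup>2 * t)"
    by (rule norm_indic_le_pieces[OF fin(2) card(4) pieceB])
  have "C * t \<le> C\<^sup>2 * t"
    using C t by (intro mult_right_mono) (auto simp: power2_eq_square)
  then have "real l * (C * t) \<le> real l * (C\<^sup>2 * t)"
    by (intro mult_left_mono) auto
  moreover have "norm (y + indic scl e \<epsilon> A)
    \<le> t + (norm (indic scl e \<epsilon> A) + norm (indic scl e \<eta> B))"
  proof -
    have "y + indic scl e \<epsilon> A = (y + indic scl e \<eta> B) + (indic scl e \<epsilon> A - indic scl e \<eta> B)"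
      by simp
    then show ?thesis
      unfolding t_def by (metis norm_triangle_mono norm_triangle_ineq4 order_refl)
  qed
  ultimately have "norm (y + indic scl e \<epsilon> A) \<le> t + (real l * (C\<^sup>2 * t) + real l * (C\<^sup>2 * t))"
    using A B by linarith
  then show ?thesis
    by (simp add: t_def algebra_simps)
qed

text \<open>Fresh indices are available after a perturbation of size \<open>\<eta>\<close>, and \<open>\<eta>\<close> tends to \<open>0\<close>.\<close>

lemma large_sets_estimate:
  assumes C: "symmetric_const scl e e' n C" "1 \<le> C" and m: "m \<in> range n"
    and fin: "finite A" "finite B" and card: "m \<le> card B" "card A \<le> l * m" "card B \<le> l * m"
    and disj: "A \<inter> B = {}" "supp e' x \<inter> (A \<union> B) = {}"
    and signs: "\<epsilon> \<in> Psi A" "\<epsilon>' \<in> Psi B" and x: "\<And>i. norm (e' i x) \<le> 1"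
  shows "norm (x + indic scl e \<epsilon> A) \<le> (1 + 2 * real l * C\<^sup>2) * norm (x + indic scl e \<epsilon>' B)"
proof (rule field_le_epsilon)
  define M where "M = 1 + 2 * real l * C\<^sup>2"
  have M: "M \<ge> 0"
    by (simp add: M_def)
  fix r :: real
  assume "r > 0"
  define \<eta> where "\<eta> = r / (1 + M)"
  have "\<eta> > 0" "(1 + M) * \<eta> = r"
    using \<open>r > 0\<close> M by (auto simp: \<eta>_def)
  then have \<eta>: "\<eta> > 0" "\<eta> + M * \<eta> = r"
    by (auto simp: distrib_right)
  obtain D y where D: "finite D" "card D = m" "D \<inter> (A \<union> B) = {}"
    and y: "norm (y - x) \<le> \<eta>" "\<And>i. e' i y = (if i \<in> D then 0 else e' i x)"
    using perturb_off_fresh_set[of "A \<union> B" \<eta> m x] \<eta> fin by (metis finite_UnI)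
  have "supp e' y \<inter> (A \<union> B \<union> D) = {}"
    using disj D by (auto simp: supp_def y)
  moreover have "norm (e' i y) \<le> 1" for i
    using x by (simp add: y)
  ultimately have est: "norm (y + indic scl e \<epsilon> A) \<le> M * norm (y + indic scl e \<epsilon>' B)"
    unfolding M_def by (intro large_sets_estimate_fresh[OF C m fin D(1,2) card disj(1) D(3)] signs)
  have "norm (x + indic scl e \<epsilon> A) \<le> norm (y + indic scl e \<epsilon> A) + \<eta>"
    using norm_triangle_ineq4[of "y + indic scl e \<epsilon> A" "y - x"] y(1) by (simp add: add.commute)
  also have "norm (y + indic scl e \<epsilon>' B) \<le> norm (x + indic scl e \<epsilon>' B) + \<eta>"
    using norm_triangle_ineq[of "x + indic scl e \<epsilon>' B" "y - x"] y(1) by (simp add: add.commute)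
  then have "norm (y + indic scl e \<epsilon> A) + \<eta> \<le> M * (norm (x + indic scl e \<epsilon>' B) + \<eta>) + \<eta>"
    using est M by (meson add_right_mono mult_left_mono order_trans)
  finally show "norm (x + indic scl e \<epsilon> A)
      \<le> (1 + 2 * real l * C\<^sup>2) * norm (x + indic scl e \<epsilon>' B) + r"
    unfolding M_def[symmetric] using \<eta>(2) by (simp add: algebra_simps)
qed

end

lemma between_consecutive_terms:
  assumes "positive_increasing n" "n 0 \<le> b"
  obtains k where "n k \<le> b" "b < n (Suc k)"
proof -
  have "b < n (Suc b)"
    using assms strict_mono_imp_increasing[of n "Suc b"] by (auto simp: positive_increasing_def)
  then show ?thesis
    using ex_least_nat_less[of "\<lambda>k. b < n k" "Suc b"] assms that by (auto simp: not_less)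
qed

section \<open>Symmetry for all sizes\<close>

theorem theorem4p13:
  fixes scl :: "'f::real_normed_field \<Rightarrow> 'a::banach \<Rightarrow> 'a"
    and e :: "nat \<Rightarrow> 'a" and e' :: "nat \<Rightarrow> 'a \<Rightarrow> 'f"
    and n :: "nat \<Rightarrow> nat" and l :: nat and \<Delta> :: real
  assumes "basis scl e e'"
    and "positive_increasing n"
    and "l \<ge> 2"
    and "bounded_quotient_gaps l n"
    and "n_symmetric_largest scl e e' n \<Delta>"
  shows "\<exists>C. symmetric_largest scl e e' C \<and>
    C \<le> max (1 + 2 * (real (n 0) - 1) * alpha1 e * alpha2 e')
            (1 + 2 * \<Delta>\<^sup>2 * (1 + real l))"
proof -
  interpret basis scl e e' by fact
  define M1 where "M1 = 1 + 2 * (real (n 0) - 1) * alpha1 e * alpha2 e'"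
  define M2 where "M2 = 1 + 2 * \<Delta>\<^sup>2 * (1 + real l)"
  have \<Delta>: "symmetric_const scl e e' n \<Delta>"
    using assms by (simp add: n_symmetric_largest_def)
  note \<Delta>1 = symmetric_const_ge_1[OF \<Delta> assms(2)]
  have "norm (x + indic scl e \<epsilon> A) \<le> max M1 M2 * norm (x + indic scl e \<epsilon>' B)"
    if fin: "finite A" "finite B" and card: "card A \<le> card B" "card B \<in> range Suc"
      and disj: "A \<inter> B = {}" "supp e' x \<inter> (A \<union> B) = {}"
      and signs: "\<epsilon> \<in> Psi A" "\<epsilon>' \<in> Psi B" and x: "\<And>i. norm (e' i x) \<le> 1" for A B \<epsilon> \<epsilon>' x
  proof (cases "card B < n 0")
    case True
    have "norm (x + indic scl e \<epsilon> A) \<le> M1 * norm (x + indic scl e \<epsilon>' B)"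
      unfolding M1_def using fin card disj signs True by (intro small_sets_estimate) auto
    also have "\<dots> \<le> max M1 M2 * norm (x + indic scl e \<epsilon>' B)"
      by (intro mult_right_mono) auto
    finally show ?thesis .
  next
    case False
    then obtain k where k: "n k \<le> card B" "card B < n (Suc k)"
      using between_consecutive_terms[OF assms(2)] by (metis not_less)
    have "real (n (Suc k)) / real (n k) \<le> real l" "n k > 0"
      using assms by (auto simp: bounded_quotient_gaps_def positive_increasing_def)
    then have "real (n (Suc k)) \<le> real (l * n k)"
      by (simp add: divide_le_eq)
    then have lk: "n (Suc k) \<le> l * n k"
      by (simp only: of_nat_le_iff)
    have "norm (x + indic scl e \<epsilon> A) \<le> (1 + 2 * real l * \<Delta>\<^sup>2) * norm (x + indic scl e \<epsilon>' B)"
      using k lk card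
      by (intro large_sets_estimate[OF \<Delta> \<Delta>1 _ fin k(1) _ _ disj signs x]) auto
    also have "\<dots> \<le> max M1 M2 * norm (x + indic scl e \<epsilon>' B)"
      by (intro mult_right_mono) (auto simp: M2_def algebra_simps le_max_iff_disj)
    finally show ?thesis .
  qed
  moreover have "max M1 M2 > 0"
    by (auto simp: M2_def less_max_iff_disj intro!: add_pos_nonneg)
  ultimately have "symmetric_const scl e e' Suc (max M1 M2)"
    unfolding symmetric_const_def by blast
  moreover have "positive_increasing Suc"
    by (simp add: positive_increasing_def strict_mono_Suc_iff)
  ultimately show ?thesis
    using smallest_symmetric_const unfolding symmetric_largest_def M1_def M2_def by blast
qed

end
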